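(* Let $m,n\geq 1$ be integers. Then $P_m\boxtimes P_n$ is isomorphic to the reduced clique graph $C_R(G)$ of some chordal graph $G$. If $n\geq 22$, then $P_n\boxtimes P_n$ is not isomorphic to the clique graph $C(G)$ of any chordal graph $G$.
   Context: All graphs are finite and simple. $P_n$ denotes the path with $n$ vertices. For disjoint graphs $G$ and $G'$, $G\boxtimes G'$ denotes the graph obtained from the union of $G$ and $G'$ by making every vertex of $G$ adjacent to every vertex of $G'$ (for $P_n\boxtimes P_n$, take two disjoint copies). A graph is chordal if every cycle with at least four vertices has a chord (an edge joining two vertices of the cycle that is not in the cycle). A clique is a set of pairwise adjacent vertices; maximal cliques are maximal with respect to inclusion. For a set $S$ of vertices, a path is $S$-avoiding if no internal vertex of the path is in $S$. The clique graph $C(G)$ of a chordal graph $G$ has the maximal cliques of $G$ as its vertices; two distinct maximal cliques are adjacent in $C(G)$ if and only if they have non-empty intersection. The reduced clique graph $C_R(G)$ has the same vertices; distinct maximal cliques $C$ and $C'$ are adjacent in $C_R(G)$ if and only if $C\cap C'\neq\emptyset$ and $C,C'$ form a separating pair, meaning that there is no $(C\cap C')$-avoiding path of $G$ from a vertex in $C-C'$ to a vertex in $C'-C$. *)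

theory Defs
  imports
    "Graph_Theory.Pair_Digraph"
    "Graph_Theory.Vertex_Walk"
    "Graph_Theory.Digraph_Isomorphism"
begin

text \<open>
  A finite simple graph is a \<open>pair_graph\<close>: a finite, loop-free, symmetric set of arcs without
  parallel arcs, where an undirected edge between \<open>u\<close> and \<open>v\<close> is the pair of arcs
  \<open>(u, v)\<close> and \<open>(v, u)\<close>.
\<close>

abbreviation graph_iso :: "'a pair_pre_digraph \<Rightarrow> 'b pair_pre_digraph \<Rightarrow> bool" where
  "graph_iso G H \<equiv> digraph_iso (with_proj G) (with_proj H)"

definition path_graph :: "nat \<Rightarrow> nat pair_pre_digraph" where
  "path_graph n =
    \<lparr> pverts = {..<n},
      parcs = {(i, j). i < n \<and> j < n \<and> (j = Suc i \<or> i = Suc j)} \<rparr>"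

text \<open>The sum type makes the two vertex sets disjoint, also when both graphs are the same.\<close>

definition graph_join ::
    "'a pair_pre_digraph \<Rightarrow> 'b pair_pre_digraph \<Rightarrow> ('a + 'b) pair_pre_digraph" where
  "graph_join G H =
    \<lparr> pverts = pverts G <+> pverts H,
      parcs = {(Inl u, Inl v) | u v. (u, v) \<in> parcs G}
            \<union> {(Inr u, Inr v) | u v. (u, v) \<in> parcs H}
            \<union> {(Inl u, Inr v) | u v. u \<in> pverts G \<and> v \<in> pverts H}
            \<union> {(Inr v, Inl u) | u v. u \<in> pverts G \<and> v \<in> pverts H} \<rparr>"

text \<open>
  A cycle is a list of arcs, so its length is its number of vertices. The library also counts the
  closed walk \<open>(u, v), (v, u)\<close> as a cycle; the bound on the length excludes it.
\<close>

definition chordal :: "'a pair_pre_digraph \<Rightarrow> bool" where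
  "chordal G \<longleftrightarrow>
    (\<forall>p. pre_digraph.cycle (with_proj G) p \<and> 4 \<le> length p \<longrightarrow>
      (\<exists>u v. u \<in> fst ` set p \<and> v \<in> fst ` set p \<and> (u, v) \<in> parcs G \<and>
        (u, v) \<notin> set p \<and> (v, u) \<notin> set p))"

definition clique :: "'a pair_pre_digraph \<Rightarrow> 'a set \<Rightarrow> bool" where
  "clique G C \<longleftrightarrow>
    C \<subseteq> pverts G \<and> (\<forall>u\<in>C. \<forall>v\<in>C. u \<noteq> v \<longrightarrow> (u, v) \<in> parcs G)"

definition maximal_cliques :: "'a pair_pre_digraph \<Rightarrow> 'a set set" where
  "maximal_cliques G = {C. clique G C \<and> (\<forall>D. clique G D \<and> C \<subseteq> D \<longrightarrow> D = C)}"

text \<open>\<open>butlast (tl p)\<close> lists the internal vertices of the path \<open>p\<close>.\<close>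

definition avoiding_path ::
    "'a pair_pre_digraph \<Rightarrow> 'a set \<Rightarrow> 'a \<Rightarrow> 'a list \<Rightarrow> 'a \<Rightarrow> bool" where
  "avoiding_path G S u p v \<longleftrightarrow>
    vpath p (with_proj G) \<and> hd p = u \<and> last p = v \<and> set (butlast (tl p)) \<inter> S = {}"

definition separating_pair :: "'a pair_pre_digraph \<Rightarrow> 'a set \<Rightarrow> 'a set \<Rightarrow> bool" where
  "separating_pair G C C' \<longleftrightarrow>
    \<not> (\<exists>u \<in> C - C'. \<exists>v \<in> C' - C. \<exists>p. avoiding_path G (C \<inter> C') u p v)"

definition clique_graph :: "'a pair_pre_digraph \<Rightarrow> 'a set pair_pre_digraph" where
  "clique_graph G =
    \<lparr> pverts = maximal_cliques G,
      parcs = {(C, C'). C \<in> maximal_cliques G \<and> C' \<in> maximal_cliques G \<and> C \<noteq> C' \<and>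
                 C \<inter> C' \<noteq> {}} \<rparr>"

definition reduced_clique_graph :: "'a pair_pre_digraph \<Rightarrow> 'a set pair_pre_digraph" where
  "reduced_clique_graph G =
    \<lparr> pverts = maximal_cliques G,
      parcs = {(C, C'). C \<in> maximal_cliques G \<and> C' \<in> maximal_cliques G \<and> C \<noteq> C' \<and>
                 C \<inter> C' \<noteq> {} \<and> separating_pair G C C'} \<rparr>"

lemma pair_graph_iff:
  "pair_graph G \<longleftrightarrow>
    finite (pverts G) \<and> parcs G \<subseteq> pverts G \<times> pverts G \<and> irrefl (parcs G) \<and> sym (parcs G)"
proof
  assume "pair_graph G"
  then interpret pair_graph G .
  show "finite (pverts G) \<and> parcs G \<subseteq> pverts G \<times> pverts G \<and> irrefl (parcs G) \<and> sym (parcs G)"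
    using pair_finite_verts in_arcsD1 in_arcsD2 pair_no_loops pair_sym_arcs
    by (fastforce simp: irrefl_def symmetric_def)
next
  assume *: "finite (pverts G) \<and> parcs G \<subseteq> pverts G \<times> pverts G \<and> irrefl (parcs G) \<and> sym (parcs G)"
  then have "finite (parcs G)" by (meson finite_SigmaI finite_subset)
  with * show "pair_graph G"
    by unfold_locales (auto simp: irrefl_def symmetric_def)
qed

lemma pair_graph_path_graph: "pair_graph (path_graph n)"
  by (auto simp: pair_graph_iff path_graph_def irrefl_def sym_def)

lemma pair_graph_graph_join: "pair_graph G \<Longrightarrow> pair_graph H \<Longrightarrow> pair_graph (graph_join G H)"
  by (auto simp: pair_graph_iff graph_join_def irrefl_def sym_def)

lemma graph_iso_iff:
  assumes "pair_graph G" "pair_graph H"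
  shows "graph_iso G H \<longleftrightarrow>
    (\<exists>f. bij_betw f (pverts G) (pverts H) \<and>
      (\<forall>u\<in>pverts G. \<forall>v\<in>pverts G. (u, v) \<in> parcs G \<longleftrightarrow> (f u, f v) \<in> parcs H))"
proof
  interpret G: pair_graph G by fact
  assume "graph_iso G H"
  then obtain h where inj: "inj_on (iso_verts h) (pverts G)"
    and arc: "\<And>a. a \<in> parcs G \<Longrightarrow> iso_verts h (fst a) = iso_tail h (iso_arcs h a) \<and>
          iso_verts h (snd a) = iso_head h (iso_arcs h a)"
    and H: "with_proj H = app_iso h (with_proj G)"
    by (auto simp: digraph_iso_def pre_digraph.digraph_isomorphism_def)
  have tail: "iso_tail h = fst" and head: "iso_head h = snd"
    and verts: "pverts H = iso_verts h ` pverts G" and arcs: "parcs H = iso_arcs h ` parcs G"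
    using H by (simp_all add: with_proj_def app_iso_def)
  have "iso_arcs h a = (iso_verts h (fst a), iso_verts h (snd a))" if "a \<in> parcs G" for a
    using arc[OF that] by (simp add: tail head)
  then have "parcs H = (\<lambda>a. (iso_verts h (fst a), iso_verts h (snd a))) ` parcs G"
    unfolding arcs by simp
  then have H_iff: "x \<in> parcs H \<longleftrightarrow>
      (\<exists>u v. (u, v) \<in> parcs G \<and> x = (iso_verts h u, iso_verts h v))" for x
    by (simp add: image_iff Bex_def)
  have "(u, v) \<in> parcs G \<longleftrightarrow> (iso_verts h u, iso_verts h v) \<in> parcs H"
    if uv: "u \<in> pverts G" "v \<in> pverts G" for u v
  proof
    assume "(iso_verts h u, iso_verts h v) \<in> parcs H"
    then obtain u' v' where *: "(u', v') \<in> parcs G"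
      and "iso_verts h u = iso_verts h u'" "iso_verts h v = iso_verts h v'"
      unfolding H_iff by blast
    then have "u = u'" "v = v'"
      using uv G.in_arcsD1[OF *] G.in_arcsD2[OF *] inj by (metis inj_onD)+
    with * show "(u, v) \<in> parcs G" by simp
  qed (use H_iff in blast)
  then show "\<exists>f. bij_betw f (pverts G) (pverts H) \<and>
      (\<forall>u\<in>pverts G. \<forall>v\<in>pverts G. (u, v) \<in> parcs G \<longleftrightarrow> (f u, f v) \<in> parcs H)"
    using inj verts by (auto simp: bij_betw_def intro!: exI[of _ "iso_verts h"])
next
  interpret G: pair_graph G by fact
  interpret H: pair_graph H by fact
  assume "\<exists>f. bij_betw f (pverts G) (pverts H) \<and>
      (\<forall>u\<in>pverts G. \<forall>v\<in>pverts G. (u, v) \<in> parcs G \<longleftrightarrow> (f u, f v) \<in> parcs H)"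
  then obtain f where inj: "inj_on f (pverts G)" and verts: "f ` pverts G = pverts H"
    and f: "\<And>u v. u \<in> pverts G \<Longrightarrow> v \<in> pverts G \<Longrightarrow> (u, v) \<in> parcs G \<longleftrightarrow> (f u, f v) \<in> parcs H"
    by (auto simp: bij_betw_def)
  define h where "h = \<lparr>iso_verts = f, iso_arcs = map_prod f f, iso_head = snd, iso_tail = fst\<rparr>"
  have "inj_on (map_prod f f) (parcs G)"
    by (rule inj_on_subset[OF map_prod_inj_on[OF inj inj]]) (use G.in_arcsD1 G.in_arcsD2 in auto)
  then have "pre_digraph.digraph_isomorphism (with_proj G) h"
    using inj G.wf_digraph by (simp add: pre_digraph.digraph_isomorphism_def h_def)
  moreover have "map_prod f f ` parcs G = parcs H"
  proof
    show "map_prod f f ` parcs G \<subseteq> parcs H"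
    proof (rule image_subsetI)
      fix a assume "a \<in> parcs G"
      moreover obtain u v where a: "a = (u, v)" by (cases a)
      ultimately show "map_prod f f a \<in> parcs H"
        using f[of u v] G.in_arcsD1[of u v] G.in_arcsD2[of u v] by simp
    qed
    show "parcs H \<subseteq> map_prod f f ` parcs G"
    proof (rule subrelI)
      fix x y assume xy: "(x, y) \<in> parcs H"
      then have "x \<in> f ` pverts G" "y \<in> f ` pverts G"
        using H.in_arcsD1 H.in_arcsD2 verts by auto
      then obtain u v where *: "u \<in> pverts G" "v \<in> pverts G" "x = f u" "y = f v" by blast
      with xy have "(u, v) \<in> parcs G" using f[of u v] by simp
      then show "(x, y) \<in> map_prod f f ` parcs G"
        by (rule rev_image_eqI) (simp add: *)
    qed
  qed
  then have "with_proj H = app_iso h (with_proj G)"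
    using verts by (simp add: with_proj_def app_iso_def h_def)
  ultimately show "graph_iso G H" by (auto simp: digraph_iso_def)
qed

lemma pair_graph_clique_graph:
  assumes "pair_graph G"
  shows "pair_graph (clique_graph G)"
proof -
  have "maximal_cliques G \<subseteq> Pow (pverts G)" by (auto simp: maximal_cliques_def clique_def)
  moreover have "finite (pverts G)" using assms by (simp add: pair_graph_iff)
  ultimately have "finite (maximal_cliques G)" by (meson finite_Pow_iff finite_subset)
  then show ?thesis by (auto simp: pair_graph_iff clique_graph_def irrefl_def sym_def)
qed

end

theory Submission
  imports Defs
begin

text \<open>
  Realising \<open>P\<^sub>m \<boxtimes> P\<^sub>n\<close> as a reduced clique graph: let \<open>G\<close> consist of two disjoint paths with
  \<open>m + 1\<close> and \<open>n + 1\<close> vertices and one further vertex \<open>z\<close> adjacent to everything. The maximal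
  cliques of \<open>G\<close> are the edges of the two paths, each extended by \<open>z\<close>, so they are lined up along
  two paths with \<open>m\<close> and \<open>n\<close> members. Any two of them share \<open>z\<close>, and adjacency in the reduced
  clique graph is only a matter of separation. Two consecutive cliques on one path also share the
  path vertex between them, whose removal together with \<open>z\<close> cuts the path there. Two
  non-consecutive cliques on one path share only \<open>z\<close>, and the rest of the path joins them.
  Cliques on different paths share only \<open>z\<close>, and without \<open>z\<close> the paths are not connected. The graph is
  chordal because its vertices can be eliminated along the paths, with \<open>z\<close> last
  (\<open>chordal_if_elimination_order\<close>); the outcome is \<open>reduced_clique_graph_double_fan\<close>.

  In a clique graph, adjacency is plain intersection, and there the join of two long paths is
  impossible. Take the first and the fourth clique \<open>A\<close>, \<open>A'\<close> on the first path and \<open>B\<close>, \<open>B'\<close> on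
  the second: \<open>A\<close> and \<open>A'\<close> are disjoint, \<open>B\<close> and \<open>B'\<close> are disjoint, and each of \<open>A\<close>, \<open>A'\<close>
  meets each of \<open>B\<close>, \<open>B'\<close>. One vertex from each of the four intersections gives a 4-cycle. It has
  a chord, and a maximal clique containing the chord meets all of \<open>A\<close>, \<open>A'\<close>, \<open>B\<close>, \<open>B'\<close>
  (\<open>maximal_clique_meeting_grid\<close>). But no vertex of a path lies within distance one of both its first
  and its fourth vertex, so no vertex of the join is equal or adjacent to all four.
\<close>

section \<open>Cycles and chords\<close>

text \<open>
  This trades the recursive notion of closed walk for a cyclic list of distinct vertices, a form in
  which a cycle may be rotated freely.
\<close>

lemma cycle_vertices_cyclic:
  assumes "pre_digraph.cycle (with_proj G) p"
  shows "set p \<subseteq> parcs G" "distinct (map fst p)" "map snd p = rotate1 (map fst p)"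
proof -
  obtain u where walk: "pre_digraph.awalk (with_proj G) u p u"
    and dist: "distinct (tl (pre_digraph.awalk_verts (with_proj G) u p))" and "p \<noteq> []"
    using assms by (auto simp: pre_digraph.cycle_def)
  then have cas: "pre_digraph.cas (with_proj G) u p u" and "set p \<subseteq> parcs G"
    by (auto simp: pre_digraph.awalk_def)
  then show "set p \<subseteq> parcs G" by simp
  have "map fst p @ [snd (last p)] = fst (hd p) # map snd p"
    using pre_digraph.awalk_verts_conv[of "with_proj G" u p]
      pre_digraph.awalk_verts_conv'[OF cas] \<open>p \<noteq> []\<close> by simp
  moreover have "fst (hd p) = u"
    using cas \<open>p \<noteq> []\<close> by (simp add: pre_digraph.cas_simp)
  moreover have "snd (last p) = u"
  proof -
    have "pre_digraph.cas (with_proj G) v p w \<Longrightarrow> snd (last p) = w" for v w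
      using \<open>p \<noteq> []\<close>
      by (induction p arbitrary: v rule: list_nonempty_induct) (auto simp: pre_digraph.cas.simps)
    then show ?thesis using cas by blast
  qed
  ultimately show snd: "map snd p = rotate1 (map fst p)"
    by (cases p) auto
  have "distinct (map snd p)"
    using dist pre_digraph.awalk_verts_conv'[OF cas] \<open>p \<noteq> []\<close> by simp
  then show "distinct (map fst p)" by (simp add: snd)
qed

text \<open>
  On a cycle, consider the vertex that comes first in the order. Its two neighbours on the
  cycle come later, so they are adjacent by the assumption on the order. On a cycle with at least four vertices they are not
  consecutive, hence the edge between them is a chord.
\<close>
lemma chordal_if_elimination_order:
  fixes r :: "'a \<Rightarrow> 'b :: linorder"
  assumes G: "pair_graph G" and inj: "inj_on r (pverts G)"
    and later: "\<And>v x y. (v, x) \<in> parcs G \<Longrightarrow> (v, y) \<in> parcs G \<Longrightarrow> x \<noteq> y \<Longrightarrow>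
      r v < r x \<Longrightarrow> r v < r y \<Longrightarrow> (x, y) \<in> parcs G"
  shows "chordal G"
  unfolding chordal_def
proof (intro allI impI, elim conjE)
  fix p assume cyc: "pre_digraph.cycle (with_proj G) p" and len: "4 \<le> length p"
  note p = cycle_vertices_cyclic[OF cyc]
  have wf: "parcs G \<subseteq> pverts G \<times> pverts G" and sym: "sym (parcs G)"
    using G by (auto simp: pair_graph_iff)
  from len have "p \<noteq> []" by auto
  then have "Min (r ` fst ` set p) \<in> r ` fst ` set p" by (intro Min_in) auto
  then obtain a where a: "a \<in> set p" "r (fst a) = Min (r ` fst ` set p)" by force
  have min: "r (fst a) \<le> r (fst b)" if "b \<in> set p" for b
    unfolding a(2) using that by (intro Min_le) auto
  obtain p1 p2 where split: "p = p1 @ a # p2" using a(1) by (meson split_list)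
  (* q is the cycle p started at its first vertex in the order *)
  define q where "q = rotate (length p1) p"
  have q: "set q = set p" "distinct (map fst q)"
    using p by (simp_all add: q_def rotate_map[symmetric])
  have snd_q: "map snd q = rotate1 (map fst q)"
    by (simp add: q_def rotate_map[symmetric] p(3) rotate1_rotate_swap)
  define v where "v = fst a"
  have "map fst q = v # map fst (p2 @ p1)"
    by (simp add: q_def split rotate_append v_def)
  moreover define rest where "rest = map fst (p2 @ p1)"
  ultimately have fst_q: "map fst q = v # rest" by simp
  have "length rest \<ge> 3" using len split by (simp add: rest_def)
  then obtain x z zs' where "rest = x # z # zs'" "zs' \<noteq> []"
    by (cases rest; cases "tl rest"; cases "tl (tl rest)") auto
  then obtain y zs where rest: "rest = x # z # zs @ [y]"
    by (metis append_butlast_last_id)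
  have set_q: "set q = set (zip (v # x # z # zs @ [y]) (x # z # zs @ [y, v]))"
    using snd_q fst_q by (metis zip_map_fst_snd append_Cons append_Nil append_assoc rest rotate1.simps(2))
  have dist: "distinct (v # x # z # zs @ [y])" using q(2) by (simp add: fst_q rest)
  have zip: "set q = {(v, x), (x, z), (y, v)} \<union> set (zip (z # zs) (zs @ [y]))"
    using zip_append[of "z # zs" "zs @ [y]" "[y]" "[v]"] by (simp add: set_q)
  have inner: "fst e \<in> set (z # zs)" if "e \<in> set (zip (z # zs) (zs @ [y]))" for e
    using that by (metis prod.collapse set_zip_leftD)
  have fst_set: "fst ` set p = set (v # x # z # zs @ [y])"
    using fst_q q(1) rest by (metis list.set_map)
  have "(v, x) \<in> parcs G" "(y, v) \<in> parcs G" using p(1) q(1) zip by auto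
  then have vx: "(v, x) \<in> parcs G" and vy: "(v, y) \<in> parcs G" using sym by (auto dest: symD)
  have less: "r v < r w" if w: "w \<in> {x, y}" for w
  proof -
    have "w \<in> fst ` set p" using fst_set w by auto
    then have "r v \<le> r w" using min by (auto simp: v_def)
    moreover have "r v \<noteq> r w"
      using inj_onD[OF inj, of v w] wf vx vy w dist by auto
    ultimately show ?thesis by simp
  qed
  have "(x, y) \<in> parcs G" using later[OF vx vy] less dist by auto
  moreover have "(x, y) \<notin> set p" "(y, x) \<notin> set p"
    using inner[of "(x, y)"] inner[of "(y, x)"] dist by (auto simp: q(1)[symmetric] zip)
  ultimately show "\<exists>u w. u \<in> fst ` set p \<and> w \<in> fst ` set p \<and> (u, w) \<in> parcs G \<and>
      (u, w) \<notin> set p \<and> (w, u) \<notin> set p"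
    using fst_set by (intro exI[of _ x] exI[of _ y]) auto
qed

lemma chordal_four_cycle:
  assumes G: "pair_graph G" and "chordal G" and dist: "distinct [a, b, c, d]"
    and arcs: "(a, b) \<in> parcs G" "(b, c) \<in> parcs G" "(c, d) \<in> parcs G" "(d, a) \<in> parcs G"
  shows "(a, c) \<in> parcs G \<or> (b, d) \<in> parcs G"
proof -
  interpret pair_graph G by fact
  have sym: "sym (parcs G)" and irr: "irrefl (parcs G)" using G by (auto simp: pair_graph_iff)
  let ?p = "[(a, b), (b, c), (c, d), (d, a)]"
  have cyc: "cycle ?p"
    using arcs dist in_arcsD1[OF arcs(1)] unfolding cycle_def
    by (intro exI[of _ a]) (auto simp: awalk_def)
  have "\<exists>u v. u \<in> fst ` set ?p \<and> v \<in> fst ` set ?p \<and> (u, v) \<in> parcs G \<and>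
      (u, v) \<notin> set ?p \<and> (v, u) \<notin> set ?p"
    by (rule \<open>chordal G\<close>[unfolded chordal_def, rule_format]) (simp add: cyc)
  then obtain u v where uv: "u \<in> fst ` set ?p" "v \<in> fst ` set ?p" "(u, v) \<in> parcs G"
      "(u, v) \<notin> set ?p" "(v, u) \<notin> set ?p"
    by blast
  then have "u \<noteq> v" using irr by (auto simp: irrefl_def)
  with uv have "{u, v} = {a, c} \<or> {u, v} = {b, d}" by auto
  with uv(3) sym show ?thesis by (auto simp: doubleton_eq_iff dest: symD)
qed

section \<open>Maximal cliques\<close>

lemma clique_in_maximal_clique:
  assumes "pair_graph G" "clique G C"
  obtains D where "D \<in> maximal_cliques G" "C \<subseteq> D"
proof -
  have "finite (pverts G)" using assms(1) by (simp add: pair_graph_iff)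
  then have "finite {D. clique G D}"
    by (rule finite_subset[rotated, OF finite_Pow_iff[THEN iffD2]]) (auto simp: clique_def)
  then have "\<exists>D \<in> {D. clique G D}. C \<subseteq> D \<and> (\<forall>E\<in>{D. clique G D}. D \<subseteq> E \<longrightarrow> D = E)"
    using assms(2) by (intro finite_has_maximal2) auto
  then show ?thesis using that by (auto simp: maximal_cliques_def)
qed

text \<open>
  The four cliques are the rows and columns of a two-by-two grid. The vertices picked in its
  four cells form a 4-cycle, and the ends of a diagonal of this cycle together lie in both rows and
  both columns.
\<close>
lemma maximal_clique_meeting_grid:
  assumes G: "pair_graph G" and "chordal G"
    and cliques: "clique G A" "clique G A'" "clique G B" "clique G B'"
    and disj: "A \<inter> A' = {}" "B \<inter> B' = {}"
    and meet: "A \<inter> B \<noteq> {}" "A \<inter> B' \<noteq> {}" "A' \<inter> B \<noteq> {}" "A' \<inter> B' \<noteq> {}"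
  obtains D where "D \<in> maximal_cliques G"
    "D \<inter> A \<noteq> {}" "D \<inter> A' \<noteq> {}" "D \<inter> B \<noteq> {}" "D \<inter> B' \<noteq> {}"
proof -
  obtain a b c d where a: "a \<in> A" "a \<in> B" and b: "b \<in> A" "b \<in> B'"
    and c: "c \<in> A'" "c \<in> B'" and d: "d \<in> A'" "d \<in> B"
    using meet by blast
  then have dist: "distinct [a, b, c, d]" using disj by auto
  then have "(a, b) \<in> parcs G" "(b, c) \<in> parcs G" "(c, d) \<in> parcs G" "(d, a) \<in> parcs G"
    using a b c d cliques by (auto simp: clique_def)
  with G \<open>chordal G\<close> dist have chord: "(a, c) \<in> parcs G \<or> (b, d) \<in> parcs G"
    by (rule chordal_four_cycle)
  have "sym (parcs G)" using G by (auto simp: pair_graph_iff)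
  with chord have "clique G {a, c} \<or> clique G {b, d}"
    using a b c d cliques by (auto simp: clique_def dest: symD)
  then obtain D where D: "D \<in> maximal_cliques G" "{a, c} \<subseteq> D \<or> {b, d} \<subseteq> D"
    using clique_in_maximal_clique[OF G] by metis
  show ?thesis by (rule that[OF D(1)]) (use D(2) a b c d in auto)
qed

section \<open>Separating pairs\<close>

text \<open>
  Certifies separation without reasoning about paths: a path that avoids \<open>C \<inter> C'\<close> and starts in
  \<open>C - C'\<close> never leaves \<open>X\<close>.
\<close>
lemma separating_pair_if_cut:
  assumes C: "C - C' \<subseteq> X" and C': "(C' - C) \<inter> X = {}"
    and closed: "\<And>u v. (u, v) \<in> parcs G \<Longrightarrow> u \<in> X \<Longrightarrow> v \<notin> C \<inter> C' \<Longrightarrow> v \<in> X"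
  shows "separating_pair G C C'"
  unfolding separating_pair_def
proof clarify
  fix u v p assume u: "u \<in> C" "u \<notin> C'" and v: "v \<in> C'" "v \<notin> C"
    and p: "avoiding_path G (C \<inter> C') u p v"
  then have walk: "vwalk p (with_proj G)" and hd: "hd p = u" and last: "last p = v"
    and inner: "set (butlast (tl p)) \<inter> (C \<inter> C') = {}"
    by (auto simp: avoiding_path_def vpath_def)
  have "p \<noteq> []" using walk by auto
  then have "set p \<subseteq> {u, v} \<union> set (butlast (tl p))"
    using hd last by (cases p; cases "tl p" rule: rev_cases) auto
  then have avoid: "set p \<inter> (C \<inter> C') = {}" using inner u v by auto
  have start: "hd p \<in> X" using hd u C by auto
  have "last p \<in> X"
    using \<open>p \<noteq> []\<close> walk avoid start
  proof (induction p rule: list_nonempty_induct)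
    case (cons x xs)
    then have "(x, hd xs) \<in> parcs G" and "vwalk xs (with_proj G)"
      by (auto simp: vwalk_def arcs_ends_def arc_to_ends_def)
    moreover have "hd xs \<notin> C \<inter> C'" using hd_in_set[OF cons.hyps] cons.prems(2) by auto
    ultimately show ?case using cons closed[of x "hd xs"] by auto
  qed auto
  then show False using last v C' by auto
qed

lemma separating_pair_sym:
  assumes G: "pair_graph G"
  shows "separating_pair G C C' \<Longrightarrow> separating_pair G C' C"
proof (rule ccontr)
  assume sep: "separating_pair G C C'" and "\<not> separating_pair G C' C"
  then obtain u v p where uv: "u \<in> C' - C" "v \<in> C - C'"
    and p: "avoiding_path G (C' \<inter> C) u p v"
    by (auto simp: separating_pair_def)
  interpret pair_graph G by fact
  have "vpath (rev p) (with_proj G)"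
    using p vwalk_rev_ex by (auto simp: avoiding_path_def vpath_def)
  moreover have "p \<noteq> []" using p by (auto simp: avoiding_path_def)
  moreover have "butlast (tl (rev p)) = rev (butlast (tl p))"
    by (metis butlast_rev butlast_tl rev_rev_ident)
  ultimately have "avoiding_path G (C \<inter> C') v (rev p) u"
    using p by (auto simp: avoiding_path_def hd_rev last_rev)
  with uv sep show False by (auto simp: separating_pair_def)
qed

section \<open>The double fan\<close>

text \<open>
  The universal vertex is \<open>0\<close>; the two paths are \<open>1, \<dots>, m + 1\<close> and \<open>m + 3, \<dots>, m + n + 3\<close>.
  Leaving out \<open>m + 2\<close> keeps the paths apart although on both of them adjacency means
  being consecutive numbers, which makes most arguments uniform in the two paths.
\<close>
definition double_fan :: "nat \<Rightarrow> nat \<Rightarrow> nat pair_pre_digraph" where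
  "double_fan m n = (let V = {..m + n + 3} - {m + 2} in
    \<lparr> pverts = V,
      parcs = {(u, v). u \<in> V \<and> v \<in> V \<and> u \<noteq> v \<and> (u = 0 \<or> v = 0 \<or> v = Suc u \<or> u = Suc v)} \<rparr>)"

definition fan_clique :: "nat \<Rightarrow> nat set" where
  "fan_clique k = {0, k, Suc k}"

lemma parcs_double_fan:
  "(u, v) \<in> parcs (double_fan m n) \<longleftrightarrow>
    u \<in> pverts (double_fan m n) \<and> v \<in> pverts (double_fan m n) \<and> u \<noteq> v \<and>
    (u = 0 \<or> v = 0 \<or> v = Suc u \<or> u = Suc v)"
  by (simp add: double_fan_def Let_def)

lemma pverts_double_fan: "v \<in> pverts (double_fan m n) \<longleftrightarrow> v \<le> m + n + 3 \<and> v \<noteq> m + 2"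
  by (simp add: double_fan_def Let_def)

lemma pair_graph_double_fan: "pair_graph (double_fan m n)"
  unfolding pair_graph_iff
  by (auto simp: parcs_double_fan irrefl_def sym_def) (simp add: double_fan_def Let_def)

lemma chordal_double_fan: "chordal (double_fan m n)"
proof (rule chordal_if_elimination_order[OF pair_graph_double_fan])
  (* elimination along both paths; the universal vertex 0 comes last *)
  let ?r = "\<lambda>v. if v = 0 then m + n + 4 else v"
  show "inj_on ?r (pverts (double_fan m n))"
    by (auto simp: inj_on_def pverts_double_fan)
  show "(x, y) \<in> parcs (double_fan m n)"
    if "(v, x) \<in> parcs (double_fan m n)" "(v, y) \<in> parcs (double_fan m n)" "x \<noteq> y"
      "?r v < ?r x" "?r v < ?r y" for v x y
    using that by (auto simp: parcs_double_fan pverts_double_fan split: if_splits)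
qed

lemma fan_clique_subset_iff:
  assumes "1 \<le> k" "1 \<le> l" shows "fan_clique k \<subseteq> fan_clique l \<longleftrightarrow> k = l"
  using assms by (auto simp: fan_clique_def)

text \<open>
  A clique with least nonzero vertex \<open>k\<close> contains at most \<open>0\<close> and \<open>k + 1\<close> besides. If \<open>k\<close> is
  the last vertex of its path, then \<open>k + 1\<close> is not a vertex and the clique extends backwards to
  \<open>k - 1\<close>, which exists as both paths have an edge.
\<close>
lemma maximal_cliques_double_fan:
  assumes "1 \<le> m" "1 \<le> n"
  shows "maximal_cliques (double_fan m n) = fan_clique ` ({1..m} \<union> {m + 3..m + n + 2})"
    (is "?M = fan_clique ` ?K")
proof -
  let ?G = "double_fan m n"
  have tri: "clique ?G (fan_clique k)" if "k \<in> ?K" for k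
    using that by (auto simp: clique_def fan_clique_def parcs_double_fan pverts_double_fan)
  have sub: "\<exists>k\<in>?K. C \<subseteq> fan_clique k" if C: "clique ?G C" for C
  proof (cases "C \<subseteq> {0}")
    case True
    then show ?thesis using assms by (intro bexI[of _ 1]) (auto simp: fan_clique_def)
  next
    case False
    define k where "k = (LEAST k. k \<in> C - {0})"
    have "\<exists>k. k \<in> C - {0}" using False by auto
    then have "k \<in> C - {0}" unfolding k_def by (rule LeastI_ex)
    then have k: "k \<in> C" "k \<noteq> 0" by auto
    have least: "k \<le> l" if "l \<in> C" "l \<noteq> 0" for l
      unfolding k_def by (rule Least_le) (use that in auto)
    have C_sub: "C \<subseteq> fan_clique k"
    proof
      fix l assume "l \<in> C"
      then show "l \<in> fan_clique k"
        using C k least[of l]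
        by (cases "l = k \<or> l = 0") (fastforce simp: clique_def parcs_double_fan fan_clique_def)+
    qed
    have k_vert: "k \<le> m + n + 3" "k \<noteq> m + 2" using C k by (auto simp: clique_def pverts_double_fan)
    show ?thesis
    proof (cases "k \<in> ?K")
      case True then show ?thesis using C_sub by blast
    next
      case False
      then have last: "k = m + 1 \<or> k = m + n + 3" using k k_vert by auto
      then have "Suc k \<notin> C" using C by (auto simp: clique_def pverts_double_fan)
      then have "C \<subseteq> fan_clique (k - 1)" using C_sub k by (auto simp: fan_clique_def)
      moreover have "k - 1 \<in> ?K" using last assms by auto
      ultimately show ?thesis by blast
    qed
  qed
  have inj: "k = l" if "k \<in> ?K" "l \<in> ?K" "fan_clique k \<subseteq> fan_clique l" for k l
    using that fan_clique_subset_iff[of k l] by auto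
  show ?thesis
  proof (intro equalityI subsetI)
    fix C assume "C \<in> ?M"
    then show "C \<in> fan_clique ` ?K" using sub tri by (fastforce simp: maximal_cliques_def)
  next
    fix C assume "C \<in> fan_clique ` ?K"
    then obtain k where k: "k \<in> ?K" "C = fan_clique k" by blast
    have "D = C" if D: "clique ?G D" "C \<subseteq> D" for D
    proof -
      obtain l where "l \<in> ?K" "D \<subseteq> fan_clique l" using sub[OF D(1)] by blast
      moreover from this have "k = l" using inj[of k l] k D by auto
      ultimately show "D = C" using D k by auto
    qed
    then show "C \<in> ?M" using tri k by (auto simp: maximal_cliques_def)
  qed
qed

text \<open>
  In the separating cases the nonzero vertices up to \<open>k\<close>, respectively those of the first path,
  are cut off from the rest. Otherwise the segment from \<open>k + 1\<close> to \<open>l\<close> of their common path avoids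
  the intersection \<open>{0}\<close>.
\<close>
lemma separating_pair_fan_cliques_less:
  assumes k: "k \<in> {1..m} \<union> {m + 3..m + n + 2}" and l: "l \<in> {1..m} \<union> {m + 3..m + n + 2}"
    and less: "k < l"
  shows "separating_pair (double_fan m n) (fan_clique k) (fan_clique l) \<longleftrightarrow> l = Suc k \<or> k \<le> m \<and> m < l"
    (is "?sep \<longleftrightarrow> ?R")
proof
  assume ?R
  then show ?sep
  proof
    assume "l = Suc k"
    then show ?sep using k
      by (intro separating_pair_if_cut[where X = "{1..k}"]) (auto simp: fan_clique_def parcs_double_fan)
  next
    assume "k \<le> m \<and> m < l"
    then show ?sep using k l
      by (intro separating_pair_if_cut[where X = "{1..Suc m}"])
        (auto simp: fan_clique_def parcs_double_fan pverts_double_fan)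
  qed
next
  let ?G = "double_fan m n"
  assume ?sep
  show ?R
  proof (rule ccontr)
    assume no: "\<not> ?R"
    then have gap: "Suc k < l" and side: "l \<le> m \<or> m < k" using less by auto
    have verts: "set [Suc k..<Suc l] \<subseteq> pverts ?G"
      using k l side gap by (auto simp: pverts_double_fan)
    have arcs: "set (vwalk_arcs [i..<j]) \<subseteq> {(x, Suc x) | x. i \<le> x \<and> Suc x < j}" for i j
    proof (induction j)
      case (Suc j)
      then show ?case by (cases "i < j") (auto simp: vwalk_arcs_append)
    qed simp
    have step: "(x, Suc x) \<in> parcs ?G" if "Suc k \<le> x" "Suc x < Suc l" for x
    proof -
      have "x \<in> pverts ?G" "Suc x \<in> pverts ?G" using verts that by (auto simp del: upt_Suc)
      then show ?thesis by (simp add: parcs_double_fan)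
    qed
    have "set (vwalk_arcs [Suc k..<Suc l]) \<subseteq> parcs ?G"
      by (rule order_trans[OF arcs]) (use step in auto)
    then have "vpath [Suc k..<Suc l] (with_proj ?G)"
      using verts gap by (intro vpathI vwalkI) (auto simp: arcs_ends_def arc_to_ends_def simp del: upt_Suc)
    moreover have "0 \<notin> set (butlast (tl [Suc k..<Suc l]))"
      by (auto simp: tl_upt simp del: upt_Suc dest: in_set_butlastD)
    ultimately have "avoiding_path ?G (fan_clique k \<inter> fan_clique l) (Suc k) [Suc k..<Suc l] l"
      using gap k by (auto simp: avoiding_path_def fan_clique_def last_upt simp del: upt_Suc)
    moreover have "Suc k \<in> fan_clique k - fan_clique l" "l \<in> fan_clique l - fan_clique k"
      using gap by (auto simp: fan_clique_def)
    ultimately show False using \<open>?sep\<close> unfolding separating_pair_def by blast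
  qed
qed

lemma separating_pair_fan_cliques:
  assumes k: "k \<in> {1..m} \<union> {m + 3..m + n + 2}" and l: "l \<in> {1..m} \<union> {m + 3..m + n + 2}"
    and "k \<noteq> l"
  shows "separating_pair (double_fan m n) (fan_clique k) (fan_clique l) \<longleftrightarrow>
    l = Suc k \<or> k = Suc l \<or> k \<le> m \<and> m < l \<or> l \<le> m \<and> m < k"
proof (cases "k < l")
  case True
  then show ?thesis using separating_pair_fan_cliques_less[OF k l] by auto
next
  case False
  then have "l < k" using \<open>k \<noteq> l\<close> by simp
  then show ?thesis
    using separating_pair_fan_cliques_less[OF l k] separating_pair_sym[OF pair_graph_double_fan] by auto
qed

lemma arcs_join_path_graphs:
  "(Inl i, Inl i') \<in> parcs (graph_join (path_graph m) (path_graph n)) \<longleftrightarrow>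
    i < m \<and> i' < m \<and> (i' = Suc i \<or> i = Suc i')"
  "(Inr j, Inr j') \<in> parcs (graph_join (path_graph m) (path_graph n)) \<longleftrightarrow>
    j < n \<and> j' < n \<and> (j' = Suc j \<or> j = Suc j')"
  "(Inl i, Inr j) \<in> parcs (graph_join (path_graph m) (path_graph n)) \<longleftrightarrow> i < m \<and> j < n"
  "(Inr j, Inl i) \<in> parcs (graph_join (path_graph m) (path_graph n)) \<longleftrightarrow> i < m \<and> j < n"
  by (auto simp: graph_join_def path_graph_def)

lemma reduced_clique_graph_double_fan:
  assumes "1 \<le> m" "1 \<le> n"
  shows "graph_iso (graph_join (path_graph m) (path_graph n))
    (reduced_clique_graph (double_fan m n))"
proof -
  let ?J = "graph_join (path_graph m) (path_graph n)" and ?H = "reduced_clique_graph (double_fan m n)"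
  let ?K = "{1..m} \<union> {m + 3..m + n + 2}"
  have M: "maximal_cliques (double_fan m n) = fan_clique ` ?K"
    by (rule maximal_cliques_double_fan[OF assms])
  have J: "pair_graph ?J" by (intro pair_graph_graph_join pair_graph_path_graph)
  have H: "pair_graph ?H"
    using separating_pair_sym[OF pair_graph_double_fan]
    by (auto simp: pair_graph_iff reduced_clique_graph_def M irrefl_def sym_def)
  define g where "g = case_sum Suc (\<lambda>j. m + 3 + j)"
  have verts_J: "pverts ?J = {..<m} <+> {..<n}" by (simp add: graph_join_def path_graph_def)
  have g: "bij_betw g (pverts ?J) ?K"
    unfolding verts_J
    by (rule bij_betwI[where g = "\<lambda>k. if k \<le> m then Inl (k - 1) else Inr (k - (m + 3))"])
      (auto simp: g_def)
  have inj: "inj_on fan_clique ?K"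
  proof (rule inj_onI)
    fix k l assume "k \<in> ?K" "l \<in> ?K" "fan_clique k = fan_clique l"
    then show "k = l" using fan_clique_subset_iff[of k l] by auto
  qed
  have "bij_betw fan_clique ?K (pverts ?H)"
    using inj by (simp add: reduced_clique_graph_def M bij_betw_def)
  with g have "bij_betw (fan_clique \<circ> g) (pverts ?J) (pverts ?H)" by (rule bij_betw_trans)
  moreover have "(u, v) \<in> parcs ?J \<longleftrightarrow> ((fan_clique \<circ> g) u, (fan_clique \<circ> g) v) \<in> parcs ?H"
    if uv: "u \<in> pverts ?J" "v \<in> pverts ?J" for u v
  proof -
    have K: "g u \<in> ?K" "g v \<in> ?K" using bij_betwE[OF g] uv by blast+
    have eq: "fan_clique (g u) = fan_clique (g v) \<longleftrightarrow> g u = g v" using inj K by (auto dest: inj_onD)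
    have "(fan_clique (g u), fan_clique (g v)) \<in> parcs ?H \<longleftrightarrow>
        g u \<noteq> g v \<and> separating_pair (double_fan m n) (fan_clique (g u)) (fan_clique (g v))"
      using K eq by (auto simp: reduced_clique_graph_def M) (auto simp: fan_clique_def)
    also have "\<dots> \<longleftrightarrow> g u \<noteq> g v \<and>
        (g v = Suc (g u) \<or> g u = Suc (g v) \<or> g u \<le> m \<and> m < g v \<or> g v \<le> m \<and> m < g u)"
      using separating_pair_fan_cliques[OF K] by blast
    also have "\<dots> \<longleftrightarrow> (u, v) \<in> parcs ?J"
      using uv unfolding verts_J
      by (cases u; cases v) (auto simp: g_def arcs_join_path_graphs)
    finally show ?thesis by simp
  qed
  ultimately show ?thesis using graph_iso_iff[OF J H] by blast
qed

section \<open>Joins of long paths and clique graphs of chordal graphs\<close>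

lemma join_of_long_paths_not_clique_graph:
  assumes "4 \<le> m" "4 \<le> n" and G: "pair_graph G" and "chordal G"
  shows "\<not> graph_iso (graph_join (path_graph m) (path_graph n)) (clique_graph G)"
proof
  let ?J = "graph_join (path_graph m) (path_graph n)"
  have verts_H: "pverts (clique_graph G) = maximal_cliques G" by (simp add: clique_graph_def)
  assume "graph_iso ?J (clique_graph G)"
  moreover have "pair_graph ?J" by (intro pair_graph_graph_join pair_graph_path_graph)
  ultimately obtain f where bij: "bij_betw f (pverts ?J) (maximal_cliques G)"
    and arcs: "\<forall>u\<in>pverts ?J. \<forall>v\<in>pverts ?J.
      (u, v) \<in> parcs ?J \<longleftrightarrow> (f u, f v) \<in> parcs (clique_graph G)"
    using graph_iso_iff[OF _ pair_graph_clique_graph[OF G], of ?J] verts_H by auto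
  have meets: "f u \<inter> f v \<noteq> {} \<longleftrightarrow> (u, v) \<in> parcs ?J"
    if "u \<in> pverts ?J" "v \<in> pverts ?J" "u \<noteq> v" for u v
  proof -
    have "f u \<in> maximal_cliques G" "f v \<in> maximal_cliques G" "f u \<noteq> f v"
      using that bij by (auto simp: bij_betw_def dest: inj_onD)
    then have "(f u, f v) \<in> parcs (clique_graph G) \<longleftrightarrow> f u \<inter> f v \<noteq> {}"
      by (simp add: clique_graph_def)
    then show ?thesis using arcs that by blast
  qed
  have in_J: "Inl i \<in> pverts ?J \<longleftrightarrow> i < m" "Inr j \<in> pverts ?J \<longleftrightarrow> j < n" for i j
    by (auto simp: graph_join_def path_graph_def)
  have cliques: "clique G (f u)" if "u \<in> pverts ?J" for u
    using that bij by (auto simp: bij_betw_def maximal_cliques_def)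
  let ?A = "f (Inl 0)" and ?A' = "f (Inl 3)" and ?B = "f (Inr 0)" and ?B' = "f (Inr 3)"
  have disj: "?A \<inter> ?A' = {}" "?B \<inter> ?B' = {}"
    using meets[of "Inl 0" "Inl 3"] meets[of "Inr 0" "Inr 3"] assms
    by (simp_all add: in_J arcs_join_path_graphs)
  have "f (Inl i) \<inter> f (Inr j) \<noteq> {}" if "i < m" "j < n" for i j
    using meets[of "Inl i" "Inr j"] that by (simp add: in_J arcs_join_path_graphs)
  then have meet: "?A \<inter> ?B \<noteq> {}" "?A \<inter> ?B' \<noteq> {}" "?A' \<inter> ?B \<noteq> {}" "?A' \<inter> ?B' \<noteq> {}"
    using assms by simp_all
  have "clique G ?A" "clique G ?A'" "clique G ?B" "clique G ?B'"
    using assms by (auto intro!: cliques simp: in_J)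
  then obtain D where D: "D \<in> maximal_cliques G"
    "D \<inter> ?A \<noteq> {}" "D \<inter> ?A' \<noteq> {}" "D \<inter> ?B \<noteq> {}" "D \<inter> ?B' \<noteq> {}"
    using maximal_clique_meeting_grid[OF G \<open>chordal G\<close> _ _ _ _ disj meet] by metis
  then obtain w where w: "w \<in> pverts ?J" "D = f w" using bij by (auto simp: bij_betw_def)
  have near: "w = u \<or> (w, u) \<in> parcs ?J" if "u \<in> pverts ?J" "D \<inter> f u \<noteq> {}" for u
    using meets[OF w(1) that(1)] that(2) w(2) by blast
  show False
    using near[of "Inl 0"] near[of "Inl 3"] near[of "Inr 0"] near[of "Inr 3"] D assms
    by (cases w) (auto simp: in_J arcs_join_path_graphs)
qed

theorem lemma3p10:
  fixes m n :: nat
  assumes "m \<ge> 1" and "n \<ge> 1"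
  shows "(\<exists>G :: nat pair_pre_digraph. pair_graph G \<and> chordal G \<and>
            graph_iso (graph_join (path_graph m) (path_graph n)) (reduced_clique_graph G)) \<and>
         (n \<ge> 22 \<longrightarrow>
           \<not> (\<exists>G :: 'a pair_pre_digraph. pair_graph G \<and> chordal G \<and>
                graph_iso (graph_join (path_graph n) (path_graph n)) (clique_graph G)))"
proof (intro conjI impI)
  show "\<exists>G :: nat pair_pre_digraph. pair_graph G \<and> chordal G \<and>
      graph_iso (graph_join (path_graph m) (path_graph n)) (reduced_clique_graph G)"
    using pair_graph_double_fan chordal_double_fan reduced_clique_graph_double_fan[OF assms] by blast
  assume "n \<ge> 22"
  then show "\<not> (\<exists>G :: 'a pair_pre_digraph. pair_graph G \<and> chordal G \<and>
      graph_iso (graph_join (path_graph n) (path_graph n)) (clique_graph G))"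
    using join_of_long_paths_not_clique_graph[of n n] by auto
qed

end
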